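(* For $d\geq 2$, the constant term (with respect to $u$) of $\overline{a}_d(q,u)$ equals $$q^{(d+1)(d-2)/2}\,\frac{1}{d}\,(q^d-1)(q^{d-1}-1)\cdots(q-1)\sum_{i\cdot j=d}\frac{\mu(i)}{(q^i-1)^j},$$ where the sum runs over all pairs $(i,j)$ of positive integers with $ij=d$ and $\mu$ is the number-theoretic Moebius function. In particular, its value at $q=1$ equals $(d-1)!$.
   Context: Two-variable polynomials $a_d(q,u)$: let $\widehat{R}=\mathbb{Q}(q,u)[[t]]$ with its $t$-adic topology and $\mathfrak{m}=t\widehat{R}$. Let ${\rm Exp}:\mathfrak{m}\to 1+\mathfrak{m}$ be the plethystic exponential, the continuous isomorphism from the additive group $\mathfrak m$ to the multiplicative group $1+\mathfrak m$ with ${\rm Exp}(q^iu^nt^d)=(1-q^iu^nt^d)^{-1}$, and let ${\rm Log}$ be its inverse; explicitly, if $\log P=L(q,u,t)$, then ${\rm Log}(P)=\sum_{i\ge1}\frac{\mu(i)}{i}L(q^i,u^i,t^i)$. Let $T$ be the $\mathbb{Q}(q,u)$-linear continuous operator on $\widehat R$ with $T(t^d)=(-1)^d(q^{-1}u)^{-d(d-1)/2}t^d$. Then $a_d(q,u)\in\mathbb{Q}(q)[u]$ is defined by $$\sum_{d\geq 1}a_d(q,u)t^d=(1-q)\cdot{\rm Log}\bigl(T^{-1}\bigl(G(t)^{-1}\bigr)\bigr),\qquad G(t)=\sum_{d\geq 0}\frac{u^{d(d+1)/2}t^d}{(1-q)\cdots(1-q^d)}.$$ For $d\ge 2$, the polynomial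 $a_d(q,u)$ is divisible by $u^d(u-1)(u-q)$ in $\mathbb{Q}(q)[u]$, and $\overline{a}_d(q,u)\in\mathbb{Q}(q)[u]$ is defined by $$a_d(q,u)=\frac{(q-1)\,u^d(u-1)(u-q)}{(q^d-1)(q^d-q)\cdots(q^d-q^{d-1})}\cdot\overline{a}_d(q,u).$$ *)

theory Defs
  imports "HOL-Computational_Algebra.Computational_Algebra"
begin

section \<open>The fields of rational functions\<close>

type_synonym Qq = "rat poly fract"  \<comment> \<open>\<open>\<rat>(q)\<close>\<close>
type_synonym Qqu = "Qq poly fract"  \<comment> \<open>\<open>\<rat>(q,u) = \<rat>(q)(u)\<close>, the fraction field of \<open>\<rat>(q)[u]\<close>\<close>

instance fract :: ("{idom,ring_char_0}") field_char_0
proof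
  show "inj (of_nat :: nat \<Rightarrow> 'a fract)"
    by (rule injI) (simp add: of_nat_fract eq_fract)
qed

text \<open>\<open>q0\<close> is \<open>q\<close> in \<open>\<rat>(q)\<close>; \<open>q1\<close> and \<open>u1\<close> are \<open>q\<close> and \<open>u\<close> in \<open>\<rat>(q,u)\<close>.\<close>
definition q0 :: Qq where "q0 = to_fract [:0, 1:]"
definition q1 :: Qqu where "q1 = to_fract [:q0:]"
definition u1 :: Qqu where "u1 = to_fract [:0, 1:]"

text \<open>
  \<open>has_value_at x c v\<close>: the rational function \<open>x\<close> is regular at \<open>c\<close> and takes the value \<open>v\<close> there.
\<close>
definition has_value_at :: "Qq \<Rightarrow> rat \<Rightarrow> rat \<Rightarrow> bool" where
  "has_value_at x c v \<longleftrightarrow>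
     (\<exists>a b. poly b c \<noteq> 0 \<and> x = Fract a b \<and> v = poly a c / poly b c)"

lemma has_value_at_unique:
  assumes "has_value_at x c v" "has_value_at x c w"
  shows "v = w"
proof -
  from assms obtain a b a' b' where
    *: "poly b c \<noteq> 0" "x = Fract a b" "v = poly a c / poly b c"
       "poly b' c \<noteq> 0" "x = Fract a' b'" "w = poly a' c / poly b' c"
    unfolding has_value_at_def by blast
  then have "b \<noteq> 0" "b' \<noteq> 0" by auto
  with * have "a * b' = a' * b" by (simp add: eq_fract)
  then have "poly a c * poly b' c = poly a' c * poly b c"
    by (metis poly_mult)
  with * show ?thesis by (simp add: frac_eq_eq)
qed


section \<open>The substitutions \<open>q \<mapsto> q\<^sup>i\<close>, \<open>u \<mapsto> u\<^sup>i\<close>, \<open>t \<mapsto> t\<^sup>i\<close>\<close>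

text \<open>
  The extension of an injective ring homomorphism to the fraction fields.  For other \<open>h\<close> the
  description need not be well-defined.
\<close>
definition map_fract :: "('a::idom \<Rightarrow> 'b::idom) \<Rightarrow> 'a fract \<Rightarrow> 'b fract" where
  "map_fract h x = (THE y. \<exists>a b. b \<noteq> 0 \<and> x = Fract a b \<and> y = Fract (h a) (h b))"

definition inj_ring_hom :: "('a::comm_ring_1 \<Rightarrow> 'b::comm_ring_1) \<Rightarrow> bool" where
  "inj_ring_hom h \<longleftrightarrow> h 1 = 1 \<and> (\<forall>x y. h (x + y) = h x + h y) \<and>
     (\<forall>x y. h (x * y) = h x * h y) \<and> (\<forall>x. h x = 0 \<longrightarrow> x = 0)"

lemma inj_ring_hom_0: "inj_ring_hom h \<Longrightarrow> h 0 = 0"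
  unfolding inj_ring_hom_def by (metis add_cancel_right_right)

lemma map_fract_Fract:
  assumes h: "inj_ring_hom h" and b: "b \<noteq> 0"
  shows "map_fract h (Fract a b) = Fract (h a) (h b)"
  unfolding map_fract_def
proof (rule the_equality)
  show "\<exists>a' b'. b' \<noteq> 0 \<and> Fract a b = Fract a' b' \<and> Fract (h a) (h b) = Fract (h a') (h b')"
    using b by blast
next
  fix y assume "\<exists>a' b'. b' \<noteq> 0 \<and> Fract a b = Fract a' b' \<and> y = Fract (h a') (h b')"
  then obtain a' b' where *: "b' \<noteq> 0" "Fract a b = Fract a' b'" "y = Fract (h a') (h b')"
    by blast
  then have "a * b' = a' * b" using b by (simp add: eq_fract)
  then have "h a * h b' = h a' * h b"
    using h unfolding inj_ring_hom_def by metis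
  moreover have "h b \<noteq> 0" "h b' \<noteq> 0"
    using h b * unfolding inj_ring_hom_def by blast+
  ultimately show "y = Fract (h a) (h b)"
    using * by (simp add: eq_fract)
qed

lemma inj_ring_hom_map_fract:
  assumes h: "inj_ring_hom h"
  shows "inj_ring_hom (map_fract h)"
proof -
  have hs: "h 1 = 1" "\<And>x y. h (x + y) = h x + h y" "\<And>x y. h (x * y) = h x * h y"
    "\<And>x. x \<noteq> 0 \<Longrightarrow> h x \<noteq> 0"
    using h unfolding inj_ring_hom_def by blast+
  have "map_fract h 1 = 1"
    using map_fract_Fract[OF h, of 1 1] hs by (simp add: One_fract_def)
  moreover have "map_fract h (x + y) = map_fract h x + map_fract h y" for x y
    by (cases x; cases y) (simp add: map_fract_Fract[OF h] hs)
  moreover have "map_fract h (x * y) = map_fract h x * map_fract h y" for x y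
    by (cases x; cases y) (simp add: map_fract_Fract[OF h] hs)
  moreover have "x = 0" if "map_fract h x = 0" for x
  proof (cases x)
    case (Fract a b)
    with that have "Fract (h a) (h b) = 0" by (simp add: map_fract_Fract[OF h])
    with Fract hs(4)[of b] have "h a = 0" by (simp add: Zero_fract_def eq_fract)
    with hs(4) have "a = 0" by blast
    with Fract show ?thesis by (simp add: fract_collapse)
  qed
  ultimately show ?thesis unfolding inj_ring_hom_def by blast
qed

definition adams_q :: "nat \<Rightarrow> Qq \<Rightarrow> Qq" where
  "adams_q i = map_fract (\<lambda>p. pcompose p (monom 1 i))"

definition adams_u :: "nat \<Rightarrow> Qq poly \<Rightarrow> Qq poly" where
  "adams_u i p = pcompose (map_poly (adams_q i) p) (monom 1 i)"

definition adams_qu :: "nat \<Rightarrow> Qqu \<Rightarrow> Qqu" where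
  "adams_qu i = map_fract (adams_u i)"

definition adams :: "nat \<Rightarrow> Qqu fps \<Rightarrow> Qqu fps" where
  "adams i L = fps_compose (Abs_fps (\<lambda>n. adams_qu i (fps_nth L n))) (fps_X ^ i)"

lemma inj_ring_hom_pcompose_monom:
  assumes "i > 0"
  shows "inj_ring_hom (\<lambda>p::'a::idom poly. pcompose p (monom 1 i))"
  unfolding inj_ring_hom_def
proof (intro conjI allI impI)
  have "degree (monom 1 i :: 'a poly) > 0" using assms by (simp add: degree_monom_eq)
  then show "p = 0" if "pcompose p (monom 1 i) = 0" for p :: "'a poly"
    using that pcompose_eq_0 by blast
qed (simp_all only: pcompose_add pcompose_mult pcompose_1)

lemma inj_ring_hom_adams_q: "i > 0 \<Longrightarrow> inj_ring_hom (adams_q i)"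
  unfolding adams_q_def by (intro inj_ring_hom_map_fract inj_ring_hom_pcompose_monom)

lemma inj_ring_hom_map_poly:
  fixes h :: "'a::idom \<Rightarrow> 'b::idom"
  assumes h: "inj_ring_hom h"
  shows "inj_ring_hom (map_poly h)"
proof -
  have hs: "h 1 = 1" "\<And>x y. h (x + y) = h x + h y" "\<And>x y. h (x * y) = h x * h y"
    "\<And>x. h x = 0 \<Longrightarrow> x = 0" and h0: "h 0 = 0"
    using h inj_ring_hom_0[OF h] unfolding inj_ring_hom_def by blast+
  have hsum: "h (sum f A) = (\<Sum>x\<in>A. h (f x))" for f :: "nat \<Rightarrow> 'a" and A
    by (induction A rule: infinite_finite_induct) (simp_all add: h0 hs)
  have "map_poly h (p * r) = map_poly h p * map_poly h r" for p r
    by (rule poly_eqI) (simp add: coeff_map_poly h0 coeff_mult hsum hs)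
  moreover have "map_poly h (p + r) = map_poly h p + map_poly h r" for p r
    by (rule poly_eqI) (simp add: coeff_map_poly h0 hs)
  moreover have "p = 0" if "map_poly h p = 0" for p
    using that hs(4) by (metis coeff_map_poly h0 poly_eqI coeff_0)
  ultimately show ?thesis
    unfolding inj_ring_hom_def by (simp add: hs)
qed

lemma inj_ring_hom_compose:
  assumes "inj_ring_hom f" "inj_ring_hom g"
  shows "inj_ring_hom (\<lambda>x. g (f x))"
  unfolding inj_ring_hom_def
proof (intro conjI allI impI)
  show "g (f 1) = 1" using assms by (metis inj_ring_hom_def)
  show "g (f (x + y)) = g (f x) + g (f y)" for x y using assms by (metis inj_ring_hom_def)
  show "g (f (x * y)) = g (f x) * g (f y)" for x y using assms by (metis inj_ring_hom_def)
  show "x = 0" if "g (f x) = 0" for x using assms that by (metis inj_ring_hom_def)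
qed

lemma inj_ring_hom_adams_u: "i > 0 \<Longrightarrow> inj_ring_hom (adams_u i)"
  unfolding adams_u_def[abs_def]
  by (rule inj_ring_hom_compose[OF inj_ring_hom_map_poly[OF inj_ring_hom_adams_q]
        inj_ring_hom_pcompose_monom])

lemma inj_ring_hom_adams_qu: "i > 0 \<Longrightarrow> inj_ring_hom (adams_qu i)"
  unfolding adams_qu_def by (intro inj_ring_hom_map_fract inj_ring_hom_adams_u)

lemma to_fract_power: "to_fract (p ^ n) = to_fract p ^ n"
  by (induction n) simp_all

lemma map_fract_to_fract:
  assumes "inj_ring_hom h"
  shows "map_fract h (to_fract p) = to_fract (h p)"
proof -
  have "h 1 = 1" using assms by (simp add: inj_ring_hom_def)
  with map_fract_Fract[OF assms, of 1 p] show ?thesis by (simp add: to_fract_def)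
qed

lemma monom_1_power: "monom (1 :: 'a::comm_ring_1) i = [:0, 1:] ^ i"
  by (simp add: monom_altdef)

lemma adams_q_q0:
  assumes "i > 0"
  shows "adams_q i q0 = q0 ^ i"
proof -
  have "pcompose [:0, 1:] (monom 1 i) = (monom 1 i :: rat poly)"
    by (simp add: pcompose_pCons)
  then show ?thesis
    unfolding adams_q_def q0_def map_fract_to_fract[OF inj_ring_hom_pcompose_monom[OF assms]]
    by (simp only: monom_1_power to_fract_power)
qed

lemma adams_u_const:
  assumes "i > 0"
  shows "adams_u i [:c:] = [:adams_q i c:]"
proof -
  have "map_poly (adams_q i) [:c:] = [:adams_q i c:]"
    by (rule poly_eqI)
      (simp add: coeff_map_poly inj_ring_hom_0[OF inj_ring_hom_adams_q[OF assms]] coeff_pCons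
        split: nat.split)
  then show ?thesis by (simp only: adams_u_def pcompose_const)
qed

lemma adams_u_u:
  assumes "i > 0"
  shows "adams_u i [:0, 1:] = [:0, 1:] ^ i"
proof -
  have "adams_q i 1 = 1" "adams_q i 0 = 0"
    using inj_ring_hom_adams_q[OF assms] inj_ring_hom_0 unfolding inj_ring_hom_def by blast+
  then have "map_poly (adams_q i) [:0, 1:] = [:0, 1:]"
    by (intro poly_eqI) (simp add: coeff_map_poly coeff_pCons split: nat.split)
  then show ?thesis by (simp add: adams_u_def pcompose_pCons monom_1_power)
qed

lemma adams_qu_to_fract:
  assumes "i > 0"
  shows "adams_qu i (to_fract p) = to_fract (adams_u i p)"
  unfolding adams_qu_def by (rule map_fract_to_fract[OF inj_ring_hom_adams_u[OF assms]])

lemma adams_qu_q1: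
  assumes "i > 0"
  shows "adams_qu i q1 = q1 ^ i"
  unfolding q1_def adams_qu_to_fract[OF assms] adams_u_const[OF assms] adams_q_q0[OF assms]
  by (simp only: to_fract_power[symmetric] poly_const_pow)

lemma adams_qu_u1:
  assumes "i > 0"
  shows "adams_qu i u1 = u1 ^ i"
  unfolding u1_def adams_qu_to_fract[OF assms] adams_u_u[OF assms] by (rule to_fract_power)

lemma adams_nth:
  "i > 0 \<Longrightarrow> fps_nth (adams i L) n = (if i dvd n then adams_qu i (fps_nth L (n div i)) else 0)"
  by (simp add: adams_def fps_nth_compose_X_power)


section \<open>The plethystic logarithm\<close>

definition moebius_mu :: "nat \<Rightarrow> int" where
  "moebius_mu n = (if squarefree n then (- 1) ^ card (prime_factors n) else 0)"

text \<open>The usual logarithm of a power series with constant coefficient \<open>1\<close>.\<close>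
definition fps_log :: "'a::field_char_0 fps \<Rightarrow> 'a fps" where
  "fps_log P = fps_compose (fps_ln 1) (P - 1)"

text \<open>
  The inverse of the plethystic exponential, given by its explicit formula
  \<open>Log(P) = \<Sum>i\<ge>1. \<mu>(i)/i \<cdot> L(q\<^sup>i,u\<^sup>i,t\<^sup>i)\<close> where \<open>L = log P\<close>.
  The topology on \<^typ>\<open>Qqu fps\<close> is the \<open>t\<close>-adic one.  The summation index is shifted:
  the summand for \<open>k\<close> is that of \<open>i = k + 1\<close>.
\<close>
definition pleth_Log :: "Qqu fps \<Rightarrow> Qqu fps" where
  "pleth_Log P =
     (\<Sum>k. fps_const (of_int (moebius_mu (Suc k)) / of_nat (Suc k)) * adams (Suc k) (fps_log P))"

lemma fps_log_nth_0: "fps_nth (fps_log P) 0 = 0"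
  by (simp add: fps_log_def)

lemma pleth_Log_sums:
  "(\<lambda>k. fps_const (of_int (moebius_mu (Suc k)) / of_nat (Suc k)) * adams (Suc k) (fps_log P)) sums
     Abs_fps (\<lambda>n. \<Sum>i | i dvd n \<and> n > 0.
       of_int (moebius_mu i) / of_nat i * adams_qu i (fps_nth (fps_log P) (n div i)))"
  (is "?f sums ?S")
  unfolding sums_def
proof (rule tendsto_fpsI)
  fix n
  define g where "g i = of_int (moebius_mu i) / of_nat i * fps_nth (adams i (fps_log P)) n" for i
  have nth: "fps_nth (\<Sum>k<m. ?f k) n = (\<Sum>i\<in>{1..m}. g i)" for m
  proof -
    have "fps_nth (\<Sum>k<m. ?f k) n = (\<Sum>k<m. g (Suc k))"
      by (simp add: fps_sum_nth g_def)
    also have "\<dots> = (\<Sum>i\<in>{1..m}. g i)"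
      by (rule sum.reindex_bij_witness[of _ "\<lambda>i. i - 1" Suc]) auto
    finally show ?thesis .
  qed
  have "(\<Sum>i\<in>{1..m}. g i) = fps_nth ?S n" if "m \<ge> n" for m
  proof (cases "n = 0")
    case True
    have "g i = 0" if "i > 0" for i
      using that inj_ring_hom_0[OF inj_ring_hom_adams_qu[OF that]] True
      by (simp add: g_def adams_nth fps_log_nth_0)
    with True show ?thesis by simp
  next
    case False
    have "(\<Sum>i\<in>{1..m}. g i) = (\<Sum>i | i dvd n. g i)"
    proof (rule sum.mono_neutral_right)
      show "{i. i dvd n} \<subseteq> {1..m}"
      proof
        fix i assume "i \<in> {i. i dvd n}"
        then have "i dvd n" by simp
        moreover from this have "i \<noteq> 0" using False by (metis dvd_0_left)
        moreover from \<open>i dvd n\<close> have "i \<le> n" using False by (simp add: dvd_imp_le)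
        ultimately show "i \<in> {1..m}" using \<open>m \<ge> n\<close> by simp
      qed
      show "\<forall>i\<in>{1..m} - {i. i dvd n}. g i = 0"
      proof
        fix i assume "i \<in> {1..m} - {i. i dvd n}"
        then have "i > 0" "\<not> i dvd n" by simp_all
        then show "g i = 0" by (simp add: g_def adams_nth)
      qed
    qed simp
    also have "\<dots> = fps_nth ?S n"
    proof -
      have "g i = of_int (moebius_mu i) / of_nat i * adams_qu i (fps_nth (fps_log P) (n div i))"
        if "i dvd n" for i
      proof -
        from that False have "i > 0" by (metis dvd_0_left gr0I)
        with that show ?thesis by (simp add: g_def adams_nth)
      qed
      with False show ?thesis by simp
    qed
    finally show ?thesis .
  qed
  then show "\<forall>\<^sub>F m in sequentially. fps_nth (\<Sum>k<m. ?f k) n = fps_nth ?S n"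
    unfolding nth by (rule eventually_sequentiallyI)
qed

lemma pleth_Log_nth:
  "fps_nth (pleth_Log P) n = (\<Sum>i | i dvd n \<and> n > 0.
     of_int (moebius_mu i) / of_nat i * adams_qu i (fps_nth (fps_log P) (n div i)))"
proof -
  have "pleth_Log P = Abs_fps (\<lambda>n. \<Sum>i | i dvd n \<and> n > 0.
      of_int (moebius_mu i) / of_nat i * adams_qu i (fps_nth (fps_log P) (n div i)))"
    unfolding pleth_Log_def by (rule sums_unique[OF pleth_Log_sums, symmetric])
  then show ?thesis by (simp only: fps_nth_Abs_fps)
qed


section \<open>The polynomials \<open>a\<^sub>d\<close> and their quotients\<close>

text \<open>
  By linearity and continuity, \<open>T\<close> acts on each coefficient by the factor in
  \<open>T(t\<^sup>d) = (-1)\<^sup>d (q\<^sup>-\<^sup>1u)\<^bsup>-d(d-1)/2\<^esup> t\<^sup>d\<close>.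
\<close>
definition T_op :: "Qqu fps \<Rightarrow> Qqu fps" where
  "T_op F = Abs_fps (\<lambda>d. (- 1) ^ d * (inverse q1 * u1) powi (- int (d * (d - 1) div 2)) * fps_nth F d)"

lemma q1_nonzero: "q1 \<noteq> 0" and u1_nonzero: "u1 \<noteq> 0"
  by (simp_all add: q1_def q0_def u1_def)

lemma inv_T_op:
  "inv T_op F = Abs_fps (\<lambda>d. (- 1) ^ d * (inverse q1 * u1) ^ (d * (d - 1) div 2) * fps_nth F d)"
  (is "_ = ?S F")
  and bij_T_op: "bij T_op"
proof -
  define x where "x = inverse q1 * u1"
  have x: "x \<noteq> 0" using q1_nonzero u1_nonzero by (simp add: x_def)
  have c: "((- 1) ^ d * x ^ n) * ((- 1) ^ d * x powi (- int n)) = 1" for d n :: nat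
  proof -
    have "x ^ n * x powi (- int n) = 1"
      using x by (simp add: power_int_minus)
    moreover have "(- 1 :: Qqu) ^ d * (- 1) ^ d = 1"
      by (simp flip: power_mult_distrib)
    ultimately have "((- 1) ^ d * (- 1) ^ d) * (x ^ n * x powi (- int n)) = 1" by (simp only: mult_1_left)
    then show ?thesis by (simp only: mult_ac)
  qed
  have ST: "?S (T_op F) = F" for F
  proof (rule fps_ext)
    fix n
    have "fps_nth (?S (T_op F)) n =
        ((- 1) ^ n * x ^ (n * (n - 1) div 2)) * ((- 1) ^ n * x powi (- int (n * (n - 1) div 2))) * fps_nth F n"
      unfolding T_op_def x_def[symmetric] fps_nth_Abs_fps by (simp only: mult.assoc)
    then show "fps_nth (?S (T_op F)) n = fps_nth F n"
      by (simp only: c mult_1_left)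
  qed
  have TS: "T_op (?S F) = F" for F
  proof (rule fps_ext)
    fix n
    have "fps_nth (T_op (?S F)) n =
        ((- 1) ^ n * x ^ (n * (n - 1) div 2)) * ((- 1) ^ n * x powi (- int (n * (n - 1) div 2))) * fps_nth F n"
      unfolding T_op_def x_def[symmetric] fps_nth_Abs_fps by (simp only: mult_ac)
    then show "fps_nth (T_op (?S F)) n = fps_nth F n"
      by (simp only: c mult_1_left)
  qed
  show "bij T_op"
    by (rule o_bij[of ?S]) (simp_all only: fun_eq_iff o_apply id_apply ST TS simp_thms)
  then have "inj T_op" by (rule bij_is_inj)
  then show "inv T_op F = ?S F" by (rule inv_f_eq) (rule TS)
qed

definition G_ser :: "Qqu fps" where
  "G_ser = Abs_fps (\<lambda>d. u1 ^ (d * (d + 1) div 2) / (\<Prod>k=1..d. 1 - q1 ^ k))"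

text \<open>\<open>a_rat d\<close> is \<open>a\<^sub>d(q,u)\<close> for \<open>d \<ge> 1\<close>, as an element of \<open>\<rat>(q,u)\<close>.\<close>
definition a_rat :: "nat \<Rightarrow> Qqu" where
  "a_rat d = fps_nth (fps_const (1 - q1) * pleth_Log (inv T_op (inverse G_ser))) d"

text \<open>
  For \<open>d \<ge> 2\<close>, the polynomial in \<open>\<rat>(q)[u]\<close> described here exists because \<open>a_rat d\<close> is a polynomial
  divisible by \<open>u\<^sup>d (u - 1) (u - q)\<close>; it is unique because the factor in front is nonzero.
\<close>
definition a_bar :: "nat \<Rightarrow> Qq poly" where
  "a_bar d = (THE p. a_rat d =
     (q1 - 1) * u1 ^ d * (u1 - 1) * (u1 - q1) / (\<Prod>k<d. q1 ^ d - q1 ^ k) * to_fract p)"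

end

theory Submission
  imports Defs
begin

text \<open>
  The definition of \<open>a\<^sub>d\<close> can be evaluated explicitly at the three values \<open>u = 0, 1, q\<close>, and these
  three evaluations determine everything that is claimed.

  Since \<open>u\<^bsup>d(d+1)/2\<^esup> = u\<^sup>d u\<^bsup>d(d-1)/2\<^esup>\<close>, the series \<open>G(t)\<close> equals \<open>H(u t)\<close> with
  \<open>H(t) = \<Sum>d. u\<^bsup>d(d-1)/2\<^esup> t\<^sup>d / ((1-q)\<cdots>(1-q\<^sup>d))\<close>, and the substitution \<open>t \<mapsto> u t\<close> commutes with inversion,
  with \<open>T\<close> and with \<open>Log\<close>.  Hence \<open>a\<^sub>d = (1-q) u\<^sup>d L\<^sub>d\<close>, where \<open>L\<^sub>d\<close> is the \<open>d\<close>-th coefficient of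
  \<open>Log (T\<^sup>-\<^sup>1 (H\<^sup>-\<^sup>1))\<close>.  All series involved have coefficients in \<open>\<rat>(q)[u]\<close>, so \<open>L\<^sub>d\<close> is a polynomial
  in \<open>u\<close> (\<open>a_rat_eq\<close>).  Giving \<open>u\<close> a value \<open>c\<close> commutes with the Adams operations, and therefore with
  \<open>Log\<close>, as soon as \<open>q \<mapsto> q\<^sup>i\<close> sends \<open>c\<close> to \<open>c\<^sup>i\<close> (\<open>eval_poly_pleth_Log\<close>).  This holds for
  \<open>c = 0, 1, q\<close>.

  At \<open>u = 1\<close> and at \<open>u = q\<close> the series \<open>T\<^sup>-\<^sup>1 (H\<^sup>-\<^sup>1)\<close> becomes the q-exponential
  \<open>\<Sum>d. t\<^sup>d / ((1-q)\<cdots>(1-q\<^sup>d))\<close> (\<open>T_poly_at_1\<close>, \<open>T_poly_at_q\<close>), whose plethystic logarithm is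
  \<open>t / (1-q)\<close> (\<open>pleth_Log_q_qexp_nth\<close>).  So for \<open>d \<ge> 2\<close> the polynomial \<open>L\<^sub>d\<close> vanishes at \<open>1\<close> and
  \<open>q\<close>.  It is therefore divisible by \<open>(u-1)(u-q)\<close>, and the quotient determines the polynomial
  \<^term>\<open>a_bar d\<close> (\<open>a_bar_eq\<close>).

  At \<open>u = 0\<close> the series becomes \<open>1 + t / (1-q)\<close> (\<open>T_poly_at_0\<close>).  Its plethystic logarithm is read
  off from the series of the logarithm and gives the Moebius sum (\<open>pleth_Log_q_linear_nth\<close>); dividing
  by the value of \<open>(u-1)(u-q)\<close> at \<open>u = 0\<close> yields the constant term (\<open>coeff_a_bar_0\<close>).

  In this formula the product \<open>(q\<^sup>d-1)\<cdots>(q-1)\<close> vanishes to order \<open>d\<close> at \<open>q = 1\<close>, while \<open>(q\<^sup>i-1)\<^sup>j\<close>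
  vanishes to order \<open>j\<close>.  Only \<open>i = 1\<close>, \<open>j = d\<close> survives at \<open>q = 1\<close>, with value \<open>d!/d = (d-1)!\<close>.
\<close>

section \<open>Field operations under injective ring homomorphisms\<close>

text \<open>
  The Adams operations and the embedding of \<open>\<rat>(q)\<close> into \<open>\<rat>(q,u)\<close> are injective ring homomorphisms
  between fields of characteristic \<open>0\<close>; the rules below push them through the closed formulas for
  coefficients of logarithms.
\<close>

lemma inj_ring_hom_field_ops:
  fixes h :: "'a::field_char_0 \<Rightarrow> 'b::field_char_0"
  assumes h: "inj_ring_hom h"
  shows inj_ring_hom_minus: "h (x - y) = h x - h y"
    and inj_ring_hom_power: "h (x ^ n) = h x ^ n"
    and inj_ring_hom_of_nat: "h (of_nat n) = of_nat n"
    and inj_ring_hom_of_int: "h (of_int m) = of_int m"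
    and inj_ring_hom_divide: "h (x / y) = h x / h y"
proof -
  have h1: "h 1 = 1" and add: "h (a + b) = h a + h b" and mult: "h (a * b) = h a * h b"
    and h0: "h a = 0 \<Longrightarrow> a = 0" for a b
    using h unfolding inj_ring_hom_def by blast+
  have minus: "h (a - b) = h a - h b" for a b
    using add[of "a - b" b] by simp
  show "h (x - y) = h x - h y" by (rule minus)
  show "h (x ^ n) = h x ^ n" by (induction n) (simp_all add: h1 mult)
  have nat: "h (of_nat n) = of_nat n" for n
    by (induction n) (simp_all add: h1 add inj_ring_hom_0[OF h])
  show "h (of_nat n) = of_nat n" by (rule nat)
  show "h (of_int m) = of_int m"
    by (cases m rule: int_diff_cases) (simp add: minus nat)
  show "h (x / y) = h x / h y"
  proof (cases "y = 0")
    case False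
    then have "h y \<noteq> 0" using h0 by blast
    moreover have "h (x / y) * h y = h x" using False by (simp flip: mult)
    ultimately show ?thesis by (simp add: field_simps)
  qed (simp add: inj_ring_hom_0[OF h])
qed

section \<open>Divisor sums of the Moebius function\<close>

lemma prime_factors_prod_primes:
  fixes P :: "nat set"
  assumes "finite P" "\<And>p. p \<in> P \<Longrightarrow> prime p"
  shows "prime_factors (\<Prod>P) = P"
  using assms
proof (induction P rule: finite_induct)
  case (insert p P)
  then have "prime p" "prime_factors (\<Prod>P) = P" by auto
  moreover have "\<Prod>P \<noteq> 0"
    using insert.prems insert.hyps by (metis insert_iff not_prime_0 prod_zero_iff)
  moreover have "p \<noteq> 0" using \<open>prime p\<close> by auto
  ultimately show ?case
    using insert.hyps by (simp add: prime_factors_product prime_prime_factors)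
qed simp

lemma squarefree_prod_primes:
  fixes P :: "nat set"
  assumes "\<And>p. p \<in> P \<Longrightarrow> prime p"
  shows "squarefree (\<Prod>P)"
  by (intro squarefree_prod_coprime) (use assms in \<open>auto intro: primes_coprime squarefree_prime\<close>)

lemma prod_prime_factors_squarefree:
  fixes n :: nat
  assumes "squarefree n"
  shows "\<Prod>(prime_factors n) = n"
proof -
  have n: "n \<noteq> 0" using assms by (metis not_squarefree_0)
  have "n = (\<Prod>p\<in>prime_factors n. p ^ multiplicity p n)"
    using n by (simp add: prime_factorization_nat)
  also have "\<dots> = (\<Prod>p\<in>prime_factors n. p)"
    using assms n by (intro prod.cong refl) (simp add: squarefree_factorial_semiring')
  finally show ?thesis by simp
qed

text \<open>
  This is the expansion of the product \<open>\<Prod>a\<in>A. (-1 + 1)\<close>.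
\<close>

lemma sum_neg_one_card_Pow:
  assumes "finite A" "A \<noteq> {}"
  shows "(\<Sum>X\<in>Pow A. (- 1) ^ card X) = (0::int)"
  using prod_add[OF assms(1), of "\<lambda>_. - 1" "\<lambda>_. 1::int"] assms
  by (simp add: card_gt_0_iff zero_power)

text \<open>
  Only squarefree divisors contribute, and these correspond to the subsets of the set of prime
  factors of \<open>n\<close>, so the sum becomes an alternating sum over a power set.
\<close>

lemma moebius_sum_divisors:
  assumes "n > 0"
  shows "(\<Sum>i | i dvd n. moebius_mu i) = (if n = 1 then 1 else 0)"
proof -
  have "(\<Sum>i | i dvd n. moebius_mu i) = (\<Sum>i | i dvd n \<and> squarefree i. (- 1) ^ card (prime_factors i))"
    using assms by (intro sum.mono_neutral_cong_right) (auto simp: moebius_mu_def)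
  also have "\<dots> = (\<Sum>X\<in>Pow (prime_factors n). (- 1) ^ card X)"
  proof (rule sum.reindex_bij_witness[of _ "\<lambda>X. \<Prod>X" prime_factors])
    fix i assume "i \<in> {i. i dvd n \<and> squarefree i}"
    with assms show "prime_factors i \<in> Pow (prime_factors n)" "\<Prod>(prime_factors i) = i"
      by (auto simp: prod_prime_factors_squarefree dest: dvd_prime_factors[rotated])
  next
    fix X assume X: "X \<in> Pow (prime_factors n)"
    then have fin: "finite X" and pr: "\<And>p. p \<in> X \<Longrightarrow> prime p"
      by (auto intro: finite_subset)
    show pf: "prime_factors (\<Prod>X) = X" using fin pr by (rule prime_factors_prod_primes)
    have "\<Prod>X dvd \<Prod>(prime_factors n)" using X by (intro prod_dvd_prod_subset) auto
    also have "\<Prod>(prime_factors n) dvd (\<Prod>p\<in>prime_factors n. p ^ multiplicity p n)"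
      using assms by (intro prod_dvd_prod dvd_power) (auto simp: prime_factors_multiplicity)
    also have "\<dots> = n" using assms by (simp add: prime_factorization_nat[symmetric])
    finally show "\<Prod>X \<in> {i. i dvd n \<and> squarefree i}"
      using squarefree_prod_primes[OF pr] by simp
  qed auto
  also have "\<dots> = (if n = 1 then 1 else 0)"
    using sum_neg_one_card_Pow[of "prime_factors n"] assms
    by (auto simp: prime_factorization_empty_iff)
  finally show ?thesis .
qed

section \<open>The logarithm of a power series\<close>

lemma fps_log_deriv:
  fixes P :: "'a::field_char_0 fps"
  assumes "fps_nth P 0 = 1"
  shows "fps_deriv (fps_log P) = inverse P * fps_deriv P"
  using assms by (simp add: fps_log_def fps_compose_deriv fps_ln_deriv fps_inverse_compose
      fps_compose_add_distrib fps_X_fps_compose_startby0)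

text \<open>
  Both sides have the logarithmic derivative of \<open>P * Q\<close> as their derivative and constant term \<open>0\<close>.
\<close>

lemma fps_log_mult:
  fixes P Q :: "'a::field_char_0 fps"
  assumes P: "fps_nth P 0 = 1" and Q: "fps_nth Q 0 = 1"
  shows "fps_log (P * Q) = fps_log P + fps_log Q"
proof -
  have "inverse P * P = 1" "inverse Q * Q = 1"
    using P Q by (simp_all add: inverse_mult_eq_1)
  then have "inverse P * inverse Q * (fps_deriv P * Q + P * fps_deriv Q)
      = inverse P * fps_deriv P + inverse Q * fps_deriv Q"
    by algebra
  with P Q have "fps_deriv (fps_log (P * Q)) = fps_deriv (fps_log P + fps_log Q)"
    by (simp add: fps_log_deriv fps_inverse_mult algebra_simps)
  then show ?thesis
    unfolding fps_deriv_eq_iff by (simp add: fps_log_nth_0)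
qed

lemma fps_log_scale:
  fixes P :: "'a::field_char_0 fps"
  assumes "fps_nth P 0 = 1"
  shows "fps_log (P oo (fps_const c * fps_X)) = fps_log P oo (fps_const c * fps_X)"
  using assms fps_compose_assoc[of "fps_const c * fps_X" "P - 1" "fps_ln 1"]
  by (simp add: fps_log_def fps_compose_sub_distrib)

lemma fps_log_linear_nth:
  fixes c :: "'a::field_char_0"
  shows "fps_nth (fps_log (1 + fps_const c * fps_X)) n =
    (if n = 0 then 0 else (- 1) ^ (n - 1) * c ^ n / of_nat n)"
  by (simp add: fps_log_def fps_compose_linear fps_ln_nth)

section \<open>The q-exponential series\<close>

lemma q0_power_eq_1_iff: "q0 ^ n = 1 \<longleftrightarrow> n = 0"
proof
  assume "q0 ^ n = 1"
  then have "to_fract (monom 1 n :: rat poly) = to_fract 1"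
    by (simp add: q0_def monom_1_power to_fract_power)
  then have "degree (monom 1 n :: rat poly) = degree (1 :: rat poly)"
    unfolding to_fract_eq_iff by (rule arg_cong)
  then show "n = 0" by (simp add: degree_monom_eq)
qed simp

lemma q0_nonzero: "q0 \<noteq> 0"
  by (simp add: q0_def)

lemma q0_neq_1: "q0 \<noteq> 1"
  using q0_power_eq_1_iff[of 1] by simp

text \<open>
  The q-Pochhammer symbol \<open>(q; q)\<^sub>n\<close>.
\<close>

definition qpoch :: "nat \<Rightarrow> Qq" where
  "qpoch n = (\<Prod>k=1..n. 1 - q0 ^ k)"

lemma qpoch_0 [simp]: "qpoch 0 = 1"
  by (simp add: qpoch_def)

lemma qpoch_Suc: "qpoch (Suc n) = (1 - q0 ^ Suc n) * qpoch n"
  by (simp add: qpoch_def mult.commute)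

lemma qpoch_nonzero: "qpoch n \<noteq> 0"
  using q0_power_eq_1_iff by (auto simp: qpoch_def)

text \<open>
  Euler's two q-exponentials: over \<open>\<rat>[[q]]\<close> the first is \<open>\<Prod>k\<ge>0. 1 / (1 - q\<^sup>k t)\<close> and the second is
  its inverse \<open>\<Prod>k\<ge>0. (1 - q\<^sup>k t)\<close>.  Infinite products are avoided by working with the
  q-difference equations that relate a series to its image under \<open>t \<mapsto> q t\<close>.
\<close>

definition qexp :: "Qq fps" where
  "qexp = Abs_fps (\<lambda>n. 1 / qpoch n)"

definition qexp_inv :: "Qq fps" where
  "qexp_inv = Abs_fps (\<lambda>n. (- 1) ^ n * q0 ^ (n * (n - 1) div 2) / qpoch n)"

lemma triangular_Suc: "Suc n * (Suc n - 1) div 2 = n + n * (n - 1) div 2"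
proof -
  have "Suc n * (Suc n - 1) = n * (n - 1) + n * 2"
    by (cases n) (simp_all add: algebra_simps)
  then show ?thesis by simp
qed

lemma qexp_q_shift: "(1 - fps_X) * qexp = qexp oo (fps_const q0 * fps_X)"
proof (rule fps_ext)
  fix n
  show "fps_nth ((1 - fps_X) * qexp) n = fps_nth (qexp oo (fps_const q0 * fps_X)) n"
  proof (cases n)
    case (Suc m)
    have "1 - q0 ^ Suc m \<noteq> 0" using q0_power_eq_1_iff[of "Suc m"] by simp
    then have "1 / qpoch (Suc m) - 1 / qpoch m = q0 ^ Suc m * (1 / qpoch (Suc m))"
      unfolding qpoch_Suc using qpoch_nonzero[of m] by (simp add: divide_simps)
    then show ?thesis
      using Suc by (simp add: fps_compose_linear qexp_def left_diff_distrib)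
  qed (simp add: fps_compose_linear qexp_def left_diff_distrib)
qed

lemma qexp_inv_q_shift: "qexp_inv = (1 - fps_X) * (qexp_inv oo (fps_const q0 * fps_X))"
proof (rule fps_ext)
  fix n
  show "fps_nth qexp_inv n = fps_nth ((1 - fps_X) * (qexp_inv oo (fps_const q0 * fps_X))) n"
  proof (cases n)
    case (Suc m)
    define c where "c = (- 1) ^ m * q0 ^ (m * (m - 1) div 2)"
    have "1 - q0 ^ Suc m \<noteq> 0" using q0_power_eq_1_iff[of "Suc m"] by simp
    then have "- (c * q0 ^ m) / qpoch (Suc m) =
        q0 ^ Suc m * (- (c * q0 ^ m) / qpoch (Suc m)) - q0 ^ m * (c / qpoch m)"
      unfolding qpoch_Suc using qpoch_nonzero[of m] by (simp add: divide_simps) algebra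
    moreover have "fps_nth qexp_inv (Suc m) = - (c * q0 ^ m) / qpoch (Suc m)"
      unfolding qexp_inv_def fps_nth_Abs_fps triangular_Suc by (simp add: c_def power_add mult_ac)
    moreover have "fps_nth qexp_inv m = c / qpoch m"
      by (simp add: qexp_inv_def c_def)
    ultimately have rec: "fps_nth qexp_inv (Suc m) =
        q0 ^ Suc m * fps_nth qexp_inv (Suc m) - q0 ^ m * fps_nth qexp_inv m"
      by (simp only:)
    have "fps_nth ((1 - fps_X) * (qexp_inv oo (fps_const q0 * fps_X))) n =
        q0 ^ Suc m * fps_nth qexp_inv (Suc m) - q0 ^ m * fps_nth qexp_inv m"
      unfolding Suc by (simp add: fps_compose_linear left_diff_distrib)
    also have "\<dots> = fps_nth qexp_inv n" unfolding Suc by (rule rec[symmetric])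
    finally show ?thesis by (rule sym)
  qed (simp add: fps_compose_linear qexp_inv_def left_diff_distrib)
qed

text \<open>
  By the two q-difference equations the product is invariant under \<open>t \<mapsto> q t\<close>.  Since \<open>q\<^sup>n \<noteq> 1\<close> for
  \<open>n > 0\<close>, only its constant coefficient survives.
\<close>

lemma qexp_mult_qexp_inv: "qexp * qexp_inv = 1"
proof (rule fps_ext)
  fix n
  let ?s = "\<lambda>f. f oo (fps_const q0 * fps_X)"
  have "?s (qexp * qexp_inv) = ?s qexp * ?s qexp_inv"
    by (simp add: fps_compose_mult_distrib)
  also have "\<dots> = qexp * ((1 - fps_X) * ?s qexp_inv)"
    unfolding qexp_q_shift[symmetric] by (simp only: mult_ac)
  also have "\<dots> = qexp * qexp_inv"
    by (simp only: qexp_inv_q_shift[symmetric])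
  finally have "fps_nth (?s (qexp * qexp_inv)) n = fps_nth (qexp * qexp_inv) n"
    by (rule arg_cong)
  then have "(q0 ^ n - 1) * fps_nth (qexp * qexp_inv) n = 0"
    by (simp add: fps_compose_linear left_diff_distrib)
  then show "fps_nth (qexp * qexp_inv) n = fps_nth 1 n"
    by (cases "n = 0") (simp_all add: q0_power_eq_1_iff qexp_def qexp_inv_def)
qed

text \<open>
  The logarithm of the q-difference equation of \<^const>\<open>qexp\<close> reads \<open>log (1 - t) + L(t) = L(q t)\<close>,
  where \<open>L\<close> is the logarithm of \<^const>\<open>qexp\<close>; compare coefficients.
\<close>

lemma fps_log_qexp_nth:
  assumes "n > 0"
  shows "fps_nth (fps_log qexp) n = 1 / (of_nat n * (1 - q0 ^ n))"
proof -
  have e0: "fps_nth qexp 0 = 1" by (simp add: qexp_def)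
  have lin: "1 - fps_X = (1 + fps_const (- 1) * fps_X :: Qq fps)" by (simp flip: fps_const_neg)
  have "fps_log (1 - fps_X) + fps_log qexp = fps_log qexp oo (fps_const q0 * fps_X)"
    by (subst fps_log_mult[symmetric]) (simp_all add: e0 qexp_q_shift fps_log_scale)
  then have "fps_nth (fps_log (1 - fps_X)) n + fps_nth (fps_log qexp) n
      = q0 ^ n * fps_nth (fps_log qexp) n"
    by (simp add: fps_eq_iff fps_compose_linear)
  moreover have "fps_nth (fps_log (1 - fps_X)) n = - 1 / (of_nat n :: Qq)"
    using assms unfolding lin fps_log_linear_nth by (cases n) (simp_all flip: power_mult_distrib)
  ultimately have "(1 - q0 ^ n) * fps_nth (fps_log qexp) n = 1 / of_nat n"
    by (simp add: algebra_simps)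
  moreover have "1 - q0 ^ n \<noteq> 0" using assms q0_power_eq_1_iff[of n] by simp
  ultimately show ?thesis using assms by (simp add: field_simps)
qed

section \<open>The plethystic logarithm over \<open>\<rat>(q)\<close>\<close>

text \<open>
  The plethystic logarithm in the variables \<open>q\<close> and \<open>t\<close> alone.  It is what remains of
  \<^const>\<open>pleth_Log\<close> when \<open>u\<close> is specialized to \<open>0\<close>, \<open>1\<close> or \<open>q\<close>.
\<close>

definition pleth_Log_q :: "Qq fps \<Rightarrow> Qq fps" where
  "pleth_Log_q P = Abs_fps (\<lambda>n. \<Sum>i | i dvd n \<and> n > 0.
     of_int (moebius_mu i) / of_nat i * adams_q i (fps_nth (fps_log P) (n div i)))"

text \<open>
  In other words \<open>Log qexp = t / (1 - q)\<close>.  The logarithm of \<^const>\<open>qexp\<close> has coefficients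
  \<open>1 / (m (1 - q\<^sup>m))\<close>, and \<open>q \<mapsto> q\<^sup>i\<close> turns the factor \<open>1 - q\<^sup>m\<close> with \<open>m = n/i\<close> into \<open>1 - q\<^sup>n\<close>.  Thus
  all divisors of \<open>n\<close> contribute with the same weight, and the Moebius sum vanishes for \<open>n > 1\<close>.
\<close>

lemma pleth_Log_q_qexp_nth:
  assumes "n > 0"
  shows "fps_nth (pleth_Log_q qexp) n = (if n = 1 then 1 / (1 - q0) else 0)"
proof -
  have "fps_nth (pleth_Log_q qexp) n = (\<Sum>i | i dvd n. of_int (moebius_mu i) / (of_nat n * (1 - q0 ^ n)))"
  proof -
    have "of_int (moebius_mu i) / of_nat i * adams_q i (fps_nth (fps_log qexp) (n div i))
        = of_int (moebius_mu i) / (of_nat n * (1 - q0 ^ n))" if "i dvd n" for i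
    proof -
      from that obtain m where n: "n = i * m" by blast
      with assms have i: "i > 0" and m: "m > 0" by auto
      have h: "inj_ring_hom (adams_q i)" using i by (rule inj_ring_hom_adams_q)
      then have h1: "adams_q i 1 = 1" and hm: "adams_q i (x * y) = adams_q i x * adams_q i y" for x y
        unfolding inj_ring_hom_def by blast+
      have "adams_q i (fps_nth (fps_log qexp) (n div i)) = 1 / (of_nat m * (1 - q0 ^ n))"
        using i m by (simp add: n fps_log_qexp_nth hm h1 inj_ring_hom_divide[OF h] inj_ring_hom_minus[OF h]
            inj_ring_hom_power[OF h] inj_ring_hom_of_nat[OF h] adams_q_q0 power_mult)
      with n show ?thesis by simp
    qed
    then show ?thesis using assms by (simp add: pleth_Log_q_def)
  qed
  also have "\<dots> = of_int (\<Sum>i | i dvd n. moebius_mu i) / (of_nat n * (1 - q0 ^ n))"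
    by (simp add: sum_divide_distrib)
  also have "\<dots> = (if n = 1 then 1 / (1 - q0) else 0)"
    using moebius_sum_divisors[OF assms] by simp
  finally show ?thesis .
qed

text \<open>
  This is the source of the Moebius sum in the constant term.  The sign \<open>(-1)\<^bsup>j-1\<^esup>\<close> of the logarithm
  is absorbed by passing from \<open>(1 - q\<^sup>i)\<^sup>j\<close> to \<open>(q\<^sup>i - 1)\<^sup>j\<close>.
\<close>

lemma pleth_Log_q_linear_nth:
  assumes "n > 0"
  shows "fps_nth (pleth_Log_q (1 + fps_const (1 / (1 - q0)) * fps_X)) n =
    - (1 / of_nat n) * (\<Sum>i | i dvd n. of_int (moebius_mu i) / (q0 ^ i - 1) ^ (n div i))"
proof -
  let ?P = "1 + fps_const (1 / (1 - q0)) * fps_X"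
  have "of_int (moebius_mu i) / of_nat i * adams_q i (fps_nth (fps_log ?P) (n div i))
      = - (1 / of_nat n) * (of_int (moebius_mu i) / (q0 ^ i - 1) ^ (n div i))" if "i dvd n" for i
  proof -
    from that obtain m where n: "n = i * m" by blast
    with assms have i: "i > 0" and m: "m > 0" by auto
    have h: "inj_ring_hom (adams_q i)" using i by (rule inj_ring_hom_adams_q)
    then have h1: "adams_q i 1 = 1" and hm: "adams_q i (x * y) = adams_q i x * adams_q i y" for x y
      unfolding inj_ring_hom_def by blast+
    have hn: "adams_q i (- 1) = - 1"
      using inj_ring_hom_of_int[OF h, of "- 1"] by simp
    have sgn: "(1 - q0 ^ i) ^ m = (- 1) ^ m * (q0 ^ i - 1) ^ m"
      by (simp flip: power_mult_distrib)
    have "adams_q i (fps_nth (fps_log ?P) (n div i)) = (- 1) ^ (m - 1) / (1 - q0 ^ i) ^ m / of_nat m"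
      using i m by (simp add: n fps_log_linear_nth hm h1 hn inj_ring_hom_divide[OF h] inj_ring_hom_minus[OF h]
          inj_ring_hom_power[OF h] inj_ring_hom_of_nat[OF h] adams_q_q0 power_divide)
    also have "\<dots> = - 1 / (q0 ^ i - 1) ^ m / of_nat m"
      unfolding sgn using m by (cases m) simp_all
    finally show ?thesis using n i by simp
  qed
  then show ?thesis using assms by (simp add: pleth_Log_q_def sum_distrib_left)
qed

section \<open>Values of rational functions at \<open>q = 1\<close>\<close>

lemma has_value_at_of_int: "has_value_at (of_int m) c (of_int m)"
proof -
  have "of_int m = Fract (of_int m :: rat poly) 1"
    by (cases m rule: int_diff_cases) (simp add: of_nat_fract)
  moreover have "poly (of_int m :: rat poly) c = of_int m"
    by simp
  ultimately show ?thesis unfolding has_value_at_def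
    by (intro exI[of _ "of_int m"] exI[of _ 1]) simp
qed

lemma has_value_at_of_nat: "has_value_at (of_nat m) c (of_nat m)"
  using has_value_at_of_int[of "int m" c] by simp

lemma has_value_at_q0: "has_value_at q0 c c"
  unfolding has_value_at_def q0_def to_fract_def
  by (intro exI[of _ "[:0, 1:]"] exI[of _ 1]) simp

lemma has_value_at_add:
  assumes "has_value_at x c v" "has_value_at y c w"
  shows "has_value_at (x + y) c (v + w)"
proof -
  from assms obtain a b a' b' where
    *: "poly b c \<noteq> 0" "x = Fract a b" "v = poly a c / poly b c"
       "poly b' c \<noteq> 0" "y = Fract a' b'" "w = poly a' c / poly b' c"
    unfolding has_value_at_def by blast
  then have "b \<noteq> 0" "b' \<noteq> 0" by auto
  with * show ?thesis unfolding has_value_at_def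
    by (intro exI[of _ "a * b' + a' * b"] exI[of _ "b * b'"]) (simp add: add_frac_eq)
qed

lemma has_value_at_mult:
  assumes "has_value_at x c v" "has_value_at y c w"
  shows "has_value_at (x * y) c (v * w)"
proof -
  from assms obtain a b a' b' where
    *: "poly b c \<noteq> 0" "x = Fract a b" "v = poly a c / poly b c"
       "poly b' c \<noteq> 0" "y = Fract a' b'" "w = poly a' c / poly b' c"
    unfolding has_value_at_def by blast
  then show ?thesis unfolding has_value_at_def
    by (intro exI[of _ "a * a'"] exI[of _ "b * b'"]) simp
qed

lemma has_value_at_divide:
  assumes "has_value_at x c v" "has_value_at y c w" "w \<noteq> 0"
  shows "has_value_at (x / y) c (v / w)"
proof -
  from assms obtain a b a' b' where
    *: "poly b c \<noteq> 0" "x = Fract a b" "v = poly a c / poly b c"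
       "poly b' c \<noteq> 0" "y = Fract a' b'" "w = poly a' c / poly b' c"
    unfolding has_value_at_def by blast
  with assms(3) show ?thesis unfolding has_value_at_def
    by (intro exI[of _ "a * b'"] exI[of _ "b * a'"]) simp
qed

lemma has_value_at_power: "has_value_at x c v \<Longrightarrow> has_value_at (x ^ n) c (v ^ n)"
  by (induction n) (use has_value_at_of_nat[of 1 c] in \<open>simp_all add: has_value_at_mult\<close>)

lemma has_value_at_sum:
  "(\<And>i. i \<in> S \<Longrightarrow> has_value_at (f i) c (v i)) \<Longrightarrow> has_value_at (sum f S) c (sum v S)"
  by (induction S rule: infinite_finite_induct)
     (use has_value_at_of_nat[of 0 c] in \<open>simp_all add: has_value_at_add\<close>)

lemma has_value_at_prod:
  "(\<And>i. i \<in> S \<Longrightarrow> has_value_at (f i) c (v i)) \<Longrightarrow> has_value_at (prod f S) c (prod v S)"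
  by (induction S rule: infinite_finite_induct)
     (use has_value_at_of_nat[of 1 c] in \<open>simp_all add: has_value_at_mult\<close>)

text \<open>
  The q-analogue of the number \<open>n\<close>; it takes the value \<open>n\<close> at \<open>q = 1\<close>.
\<close>

definition qnum :: "nat \<Rightarrow> Qq" where
  "qnum n = (\<Sum>m<n. q0 ^ m)"

lemma qnum_eq: "q0 ^ n - 1 = (q0 - 1) * qnum n"
  by (simp add: qnum_def power_diff_1_eq)

lemma has_value_at_qnum: "has_value_at (qnum n) 1 (of_nat n)"
proof -
  have "has_value_at (qnum n) 1 (\<Sum>m<n. 1 ^ m)"
    unfolding qnum_def by (intro has_value_at_sum has_value_at_power has_value_at_q0)
  then show ?thesis by simp
qed

text \<open>
  At \<open>q = 1\<close> the numerator vanishes to order \<open>d\<close> and the denominator only to order \<open>j\<close>, which is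
  smaller than \<open>d\<close> unless \<open>i = 1\<close>.  For \<open>i = 1\<close> the quotient is the q-factorial of \<open>d\<close>.
\<close>

lemma has_value_at_q_fact_div:
  assumes "i * j = d" "d > 0"
  shows "has_value_at ((\<Prod>k=1..d. q0 ^ k - 1) / (q0 ^ i - 1) ^ j) 1 (if i = 1 then fact d else 0)"
proof -
  have ij: "i > 0" "j > 0" using assms by auto
  then have "j \<le> d" using assms by (metis dvd_imp_le dvd_triv_right)
  have nz: "q0 - 1 \<noteq> 0" using q0_neq_1 by simp
  have "(\<Prod>k=1..d. q0 ^ k - 1) / (q0 ^ i - 1) ^ j
      = (q0 - 1) ^ (d - j) * ((\<Prod>k=1..d. qnum k) / qnum i ^ j)"
    using nz \<open>j \<le> d\<close>
    by (simp add: qnum_eq prod.distrib power_mult_distrib power_diff)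
  moreover have "has_value_at (q0 - 1) 1 0"
    using has_value_at_add[OF has_value_at_q0[of 1] has_value_at_of_int[of "- 1" 1]] by simp
  then have "has_value_at ((q0 - 1) ^ (d - j) * ((\<Prod>k=1..d. qnum k) / qnum i ^ j)) 1
      (0 ^ (d - j) * ((\<Prod>k=1..d. of_nat k) / of_nat i ^ j))"
    using ij by (intro has_value_at_mult has_value_at_divide has_value_at_power has_value_at_prod
        has_value_at_qnum) auto
  moreover have "0 ^ (d - j) * ((\<Prod>k=1..d. of_nat k) / of_nat i ^ j) = (if i = 1 then fact d else 0 :: rat)"
  proof (cases "i = 1")
    case False
    then have "1 * j < i * j" using ij by (intro mult_strict_right_mono) auto
    then show ?thesis using False assms(1) by (simp add: zero_power)
  next
    case True
    then have "j = d" using assms(1) by simp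
    then show ?thesis using True by (simp add: fact_prod)
  qed
  ultimately show ?thesis by simp
qed

lemma moebius_mu_1 [simp]: "moebius_mu (Suc 0) = 1"
  using moebius_sum_divisors[of 1] by simp

text \<open>
  After the product has been moved into the sum, every summand is regular at \<open>q = 1\<close>, and only the
  one for \<open>i = 1\<close> has a nonzero value there.
\<close>

lemma has_value_at_const_term:
  assumes "d > 0"
  shows "has_value_at (q0 ^ e * (1 / of_nat d) * (\<Prod>k=1..d. q0 ^ k - 1) *
      (\<Sum>i | i dvd d. of_int (moebius_mu i) / (q0 ^ i - 1) ^ (d div i))) 1 (fact (d - 1))"
    (is "has_value_at ?x 1 _")
proof -
  have fin: "finite {i. i dvd d}" using assms by simp
  have eq: "?x = q0 ^ e * (1 / of_nat d) *
      (\<Sum>i | i dvd d. of_int (moebius_mu i) * ((\<Prod>k=1..d. q0 ^ k - 1) / (q0 ^ i - 1) ^ (d div i)))"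
    by (simp add: sum_distrib_left mult_ac)
  have val: "has_value_at (q0 ^ e * (1 / of_nat d) *
      (\<Sum>i | i dvd d. of_int (moebius_mu i) * ((\<Prod>k=1..d. q0 ^ k - 1) / (q0 ^ i - 1) ^ (d div i)))) 1
      (1 ^ e * (of_nat 1 / of_nat d) * (\<Sum>i | i dvd d. of_int (moebius_mu i) * (if i = 1 then fact d else 0)))"
    using assms has_value_at_of_nat[of 1 1]
    by (intro has_value_at_mult has_value_at_power has_value_at_q0 has_value_at_divide has_value_at_sum
        has_value_at_of_nat has_value_at_of_int has_value_at_q_fact_div) auto
  have sum: "(\<Sum>i | i dvd d. of_int (moebius_mu i) * (if i = 1 then fact d else 0)) = (fact d :: rat)"
    using fin by (simp add: if_distrib[of "\<lambda>x. _ * x"] sum.delta cong: if_cong)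
  have fact: "fact d / of_nat d = (fact (d - 1) :: rat)"
    using assms by (cases d) (simp_all del: of_nat_Suc)
  have "1 ^ e * (of_nat 1 / of_nat d) *
      (\<Sum>i | i dvd d. of_int (moebius_mu i) * (if i = 1 then fact d else 0)) = (fact (d - 1) :: rat)"
    unfolding sum using fact by simp
  with val show ?thesis unfolding eq by (simp only:)
qed

section \<open>Power series over \<open>\<rat>(q)[u]\<close> and their specializations\<close>

definition coeff_map :: "('a \<Rightarrow> 'b) \<Rightarrow> 'a fps \<Rightarrow> 'b fps" where
  "coeff_map h P = Abs_fps (\<lambda>n. h (fps_nth P n))"

lemma coeff_map_nth [simp]: "fps_nth (coeff_map h P) n = h (fps_nth P n)"
  by (simp add: coeff_map_def)

locale comm_ring_hom =
  fixes h :: "'a::comm_ring_1 \<Rightarrow> 'b::comm_ring_1"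
  assumes hom_1: "h 1 = 1"
    and hom_add: "h (x + y) = h x + h y"
    and hom_mult: "h (x * y) = h x * h y"
begin

lemma hom_0: "h 0 = 0"
  using hom_add[of 0 0] by simp

lemma hom_diff: "h (x - y) = h x - h y"
  using hom_add[of "x - y" y] by simp

lemma hom_sum: "h (sum f S) = (\<Sum>x\<in>S. h (f x))"
  by (induction S rule: infinite_finite_induct) (simp_all add: hom_0 hom_add)

lemma coeff_map_1: "coeff_map h 1 = 1"
  by (rule fps_ext) (simp add: hom_0 hom_1)

lemma coeff_map_diff: "coeff_map h (P - Q) = coeff_map h P - coeff_map h Q"
  by (rule fps_ext) (simp add: hom_diff)

lemma coeff_map_mult: "coeff_map h (P * Q) = coeff_map h P * coeff_map h Q"
  by (rule fps_ext) (simp add: fps_mult_nth hom_sum hom_mult)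

lemma coeff_map_power: "coeff_map h (P ^ n) = coeff_map h P ^ n"
  by (induction n) (simp_all add: coeff_map_1 coeff_map_mult)

lemma coeff_map_compose:
  "coeff_map h (P oo Q) = coeff_map h P oo coeff_map h Q"
  by (rule fps_ext) (simp add: fps_compose_nth hom_sum hom_mult flip: coeff_map_power)

end

interpretation eval_hom: comm_ring_hom "\<lambda>p. poly p c" for c :: "'a::comm_ring_1"
  by unfold_locales simp_all

interpretation to_fract_hom: comm_ring_hom "to_fract :: 'a::idom \<Rightarrow> 'a fract"
  by unfold_locales simp_all

lemma inj_ring_hom_const: "inj_ring_hom (\<lambda>a::'a::idom. to_fract [:a:])"
  unfolding inj_ring_hom_def
  by (simp add: to_fract_mult[symmetric] to_fract_add[symmetric] one_pCons del: to_fract_mult to_fract_add)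
   (metis to_fract_1 one_pCons)

text \<open>
  The logarithm involves only divisions by integers, so it makes sense over \<open>\<rat>(q)[u]\<close>.  It lies
  between \<^const>\<open>fps_log\<close> over \<open>\<rat>(q,u)\<close>, into which it embeds, and \<^const>\<open>fps_log\<close> over \<open>\<rat>(q)\<close>,
  to which it specializes when \<open>u\<close> is given a value.
\<close>

definition poly_log :: "Qq poly fps \<Rightarrow> Qq poly fps" where
  "poly_log P = coeff_map (\<lambda>a. [:a:]) (fps_ln 1) oo (P - 1)"

lemma eval_poly_log: "coeff_map (\<lambda>p. poly p c) (poly_log P) = fps_log (coeff_map (\<lambda>p. poly p c) P)"
proof -
  have "coeff_map (\<lambda>p. poly p c) (coeff_map (\<lambda>a. [:a:]) (fps_ln 1)) = fps_ln 1"
    by (rule fps_ext) simp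
  then show ?thesis
    by (simp add: poly_log_def fps_log_def eval_hom.coeff_map_compose eval_hom.coeff_map_diff
        eval_hom.coeff_map_1)
qed

lemma to_fract_poly_log: "coeff_map to_fract (poly_log P) = fps_log (coeff_map to_fract P)"
proof -
  have "to_fract [:fps_nth (fps_ln 1) n:] = (fps_nth (fps_ln 1) n :: Qqu)" for n
  proof -
    have "(\<lambda>a::Qq. to_fract [:a:]) (of_int ((- 1) ^ (n - 1)) / of_nat n) = of_int ((- 1) ^ (n - 1)) / of_nat n"
      unfolding inj_ring_hom_divide[OF inj_ring_hom_const] inj_ring_hom_of_int[OF inj_ring_hom_const]
        inj_ring_hom_of_nat[OF inj_ring_hom_const] ..
    then show ?thesis by (simp add: fps_ln_nth)
  qed
  then have "coeff_map to_fract (coeff_map (\<lambda>a. [:a:]) (fps_ln 1)) = (fps_ln 1 :: Qqu fps)"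
    by (intro fps_ext) simp
  then show ?thesis
    by (simp add: poly_log_def fps_log_def to_fract_hom.coeff_map_compose to_fract_hom.coeff_map_diff
        to_fract_hom.coeff_map_1)
qed

section \<open>The plethystic logarithm over \<open>\<rat>(q)[u]\<close>\<close>

definition poly_pleth_Log :: "Qq poly fps \<Rightarrow> Qq poly fps" where
  "poly_pleth_Log P = Abs_fps (\<lambda>n. \<Sum>i | i dvd n \<and> n > 0.
     smult (of_int (moebius_mu i) / of_nat i) (adams_u i (fps_nth (poly_log P) (n div i))))"

lemma to_fract_poly_pleth_Log:
  "coeff_map to_fract (poly_pleth_Log P) = pleth_Log (coeff_map to_fract P)"
proof (rule fps_ext)
  fix n
  have "to_fract (smult (of_int (moebius_mu i) / of_nat i) (adams_u i (fps_nth (poly_log P) (n div i))))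
      = of_int (moebius_mu i) / of_nat i * adams_qu i (fps_nth (fps_log (coeff_map to_fract P)) (n div i))"
    if "i dvd n" "n > 0" for i
  proof -
    have "i > 0" using that by (metis dvd_0_left gr0I)
    moreover have "to_fract [:of_int (moebius_mu i) / of_nat i :: Qq:] = of_int (moebius_mu i) / of_nat i"
      using inj_ring_hom_divide[OF inj_ring_hom_const] inj_ring_hom_of_int[OF inj_ring_hom_const]
        inj_ring_hom_of_nat[OF inj_ring_hom_const] by metis
    moreover have "smult (of_int (moebius_mu i) / of_nat i) p = [:of_int (moebius_mu i) / of_nat i:] * p"
      for p :: "Qq poly" by simp
    ultimately show ?thesis
      by (simp only: to_fract_mult adams_qu_to_fract to_fract_poly_log[symmetric] coeff_map_nth)
  qed
  then show "fps_nth (coeff_map to_fract (poly_pleth_Log P)) n = fps_nth (pleth_Log (coeff_map to_fract P)) n"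
    unfolding pleth_Log_nth coeff_map_nth poly_pleth_Log_def fps_nth_Abs_fps to_fract_sum
    by (intro sum.cong refl) blast
qed

lemma poly_map_poly_hom:
  assumes h: "inj_ring_hom h"
  shows "poly (map_poly h p) (h c) = h (poly p c)"
proof (induction p)
  case (pCons a p)
  have "h (a + c * poly p c) = h a + h c * h (poly p c)"
    using h unfolding inj_ring_hom_def by metis
  with pCons show ?case
    by (simp add: map_poly_pCons inj_ring_hom_0[OF h])
qed (simp add: inj_ring_hom_0[OF h])

text \<open>
  Specialization at \<open>u = c\<close> commutes with the Adams operations as soon as \<open>q \<mapsto> q\<^sup>i\<close> maps \<open>c\<close> to
  \<open>c\<^sup>i\<close>.  The values \<open>0\<close>, \<open>1\<close> and \<open>q\<close> have this property.
\<close>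

lemma poly_adams_u:
  assumes "i > 0" "adams_q i c = c ^ i"
  shows "poly (adams_u i p) c = adams_q i (poly p c)"
  using poly_map_poly_hom[OF inj_ring_hom_adams_q[OF assms(1)], of p c] assms(2)
  by (simp add: adams_u_def poly_pcompose poly_monom)

lemma eval_poly_pleth_Log:
  assumes "\<And>i. i > 0 \<Longrightarrow> adams_q i c = c ^ i"
  shows "coeff_map (\<lambda>p. poly p c) (poly_pleth_Log P) = pleth_Log_q (coeff_map (\<lambda>p. poly p c) P)"
proof (rule fps_ext)
  fix n
  have "poly (adams_u i (fps_nth (poly_log P) m)) c
      = adams_q i (fps_nth (fps_log (coeff_map (\<lambda>p. poly p c) P)) m)" if "i dvd n" "n > 0" for i m
  proof -
    have "i > 0" using that by (metis dvd_0_left gr0I)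
    with assms show ?thesis by (simp add: poly_adams_u flip: eval_poly_log)
  qed
  then show "fps_nth (coeff_map (\<lambda>p. poly p c) (poly_pleth_Log P)) n
      = fps_nth (pleth_Log_q (coeff_map (\<lambda>p. poly p c) P)) n"
    unfolding coeff_map_nth poly_pleth_Log_def pleth_Log_q_def fps_nth_Abs_fps poly_sum poly_smult
    by (intro sum.cong refl) auto
qed

text \<open>
  Substituting \<open>u t\<close> for \<open>t\<close> commutes with all Adams operations, because these act on \<open>u\<close> and \<open>t\<close> in
  the same way.
\<close>

lemma pleth_Log_scale_u:
  assumes "fps_nth P 0 = 1"
  shows "pleth_Log (P oo (fps_const u1 * fps_X)) = pleth_Log P oo (fps_const u1 * fps_X)"
proof (rule fps_ext)
  fix n
  have "adams_qu i (u1 ^ (n div i) * x) = u1 ^ n * adams_qu i x" if "i dvd n" "n > 0" for i x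
  proof -
    have "i > 0" using that by (metis dvd_0_left gr0I)
    then have h: "inj_ring_hom (adams_qu i)" by (rule inj_ring_hom_adams_qu)
    then have "adams_qu i (u1 ^ (n div i) * x) = (u1 ^ i) ^ (n div i) * adams_qu i x"
      using \<open>i > 0\<close> inj_ring_hom_power[OF h] unfolding inj_ring_hom_def by (metis adams_qu_u1)
    then show ?thesis using that(1) by (simp flip: power_mult)
  qed
  then show "fps_nth (pleth_Log (P oo (fps_const u1 * fps_X))) n
      = fps_nth (pleth_Log P oo (fps_const u1 * fps_X)) n"
    unfolding pleth_Log_nth fps_log_scale[OF assms]
    unfolding fps_compose_linear fps_nth_Abs_fps pleth_Log_nth sum_distrib_left
    by (intro sum.cong refl) (simp add: mult.left_commute)
qed

section \<open>Polynomiality of \<open>a\<^sub>d\<close>\<close>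

text \<open>
  Since \<open>d(d+1)/2 = d + d(d-1)/2\<close>, the series \<^const>\<open>G_ser\<close> is obtained from this one by the
  substitution \<open>t \<mapsto> u t\<close>.  The substitution accounts for the factor \<open>u\<^sup>d\<close> of \<open>a\<^sub>d\<close>.
\<close>

definition H_poly :: "Qq poly fps" where
  "H_poly = Abs_fps (\<lambda>n. monom (1 / qpoch n) (n * (n - 1) div 2))"

definition H_poly_inv :: "Qq poly fps" where
  "H_poly_inv = fps_right_inverse H_poly 1"

text \<open>
  The inverse of \<^const>\<open>T_op\<close>, acting on series with coefficients in \<open>\<rat>(q)[u]\<close>.
\<close>

definition T_poly :: "Qq poly fps \<Rightarrow> Qq poly fps" where
  "T_poly K = Abs_fps (\<lambda>n. (- 1) ^ n * monom ((1 / q0) ^ (n * (n - 1) div 2)) (n * (n - 1) div 2) * fps_nth K n)"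

lemma H_poly_inv: "H_poly * H_poly_inv = 1"
  unfolding H_poly_inv_def by (rule fps_right_inverse) (simp add: H_poly_def)

lemma H_poly_inv_nth_0: "fps_nth H_poly_inv 0 = 1"
  by (simp add: H_poly_inv_def)

lemma to_fract_monom: "to_fract (monom a n) = to_fract [:a:] * u1 ^ n"
proof -
  have "monom a n = [:a:] * [:0, 1:] ^ n" by (simp add: monom_altdef)
  then show ?thesis by (simp only: to_fract_mult to_fract_power u1_def)
qed

lemma const_qpoch: "to_fract [:1 / qpoch n:] = 1 / (\<Prod>k=1..n. 1 - q1 ^ k)"
proof -
  note h = inj_ring_hom_const[where 'a = Qq]
  have h1: "to_fract [:1::Qq:] = 1" and hm: "to_fract [:a * b:] = to_fract [:a:] * to_fract [:b:]" for a b :: Qq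
    using h unfolding inj_ring_hom_def by blast+
  have "to_fract [:qpoch n:] = (\<Prod>k=1..n. 1 - q1 ^ k)"
  proof (induction n)
    case (Suc n)
    have "to_fract [:1 - q0 ^ Suc n:] = 1 - q1 ^ Suc n"
      unfolding inj_ring_hom_minus[OF h] inj_ring_hom_power[OF h] h1 q1_def ..
    with Suc show ?case by (simp add: qpoch_Suc hm mult.commute)
  qed (simp add: h1)
  then show ?thesis unfolding inj_ring_hom_divide[OF h] h1 by simp
qed

lemma G_ser_eq: "G_ser = coeff_map to_fract H_poly oo (fps_const u1 * fps_X)"
proof (rule fps_ext)
  fix n :: nat
  have "n * (n + 1) div 2 = n + n * (n - 1) div 2"
    using triangular_Suc[of n] by (simp add: mult.commute)
  then show "fps_nth G_ser n = fps_nth (coeff_map to_fract H_poly oo (fps_const u1 * fps_X)) n"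
    by (simp only: G_ser_def fps_compose_linear fps_nth_Abs_fps coeff_map_nth H_poly_def to_fract_monom
        const_qpoch power_add) (simp add: mult_ac)
qed

lemma inverse_G_ser: "inverse G_ser = coeff_map to_fract H_poly_inv oo (fps_const u1 * fps_X)"
proof -
  have "coeff_map to_fract H_poly * coeff_map to_fract H_poly_inv = 1"
    using to_fract_hom.coeff_map_mult[of H_poly H_poly_inv] by (simp add: H_poly_inv to_fract_hom.coeff_map_1)
  then have "G_ser * (coeff_map to_fract H_poly_inv oo (fps_const u1 * fps_X)) = 1"
    by (simp add: G_ser_eq flip: fps_compose_mult_distrib)
  then show ?thesis by (rule fps_inverse_unique)
qed

lemma inv_T_op_inverse_G_ser:
  "inv T_op (inverse G_ser) = coeff_map to_fract (T_poly H_poly_inv) oo (fps_const u1 * fps_X)"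
proof (rule fps_ext)
  fix n
  note h = inj_ring_hom_const[where 'a = Qq]
  have h1: "to_fract [:1::Qq:] = 1" using h unfolding inj_ring_hom_def by blast
  have q_inv: "to_fract [:(1 / q0) ^ m:] = inverse q1 ^ m" for m
    unfolding inj_ring_hom_power[OF h] inj_ring_hom_divide[OF h] h1 q1_def by (simp add: inverse_eq_divide)
  have sgn: "to_fract ((- 1) ^ n :: Qq poly) = (- 1) ^ n"
    by (simp add: to_fract_power)
  show "fps_nth (inv T_op (inverse G_ser)) n
      = fps_nth (coeff_map to_fract (T_poly H_poly_inv) oo (fps_const u1 * fps_X)) n"
    unfolding inv_T_op fps_nth_Abs_fps inverse_G_ser fps_compose_linear coeff_map_nth T_poly_def
      to_fract_mult to_fract_monom power_mult_distrib q_inv sgn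
    by (simp only: mult_ac)
qed

lemma T_poly_H_poly_inv_nth_0: "fps_nth (T_poly H_poly_inv) 0 = 1"
  by (simp add: T_poly_def H_poly_inv_nth_0)

lemma a_rat_eq:
  "a_rat d = (1 - q1) * u1 ^ d * to_fract (fps_nth (poly_pleth_Log (T_poly H_poly_inv)) d)"
proof -
  have "fps_nth (coeff_map to_fract (T_poly H_poly_inv)) 0 = 1"
    by (simp add: T_poly_H_poly_inv_nth_0)
  then have "pleth_Log (inv T_op (inverse G_ser)) =
      coeff_map to_fract (poly_pleth_Log (T_poly H_poly_inv)) oo (fps_const u1 * fps_X)"
    unfolding inv_T_op_inverse_G_ser to_fract_poly_pleth_Log by (rule pleth_Log_scale_u)
  then show ?thesis
    by (simp add: a_rat_def fps_compose_linear mult.assoc)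
qed

section \<open>The specializations \<open>u = 1\<close>, \<open>u = q\<close> and \<open>u = 0\<close>\<close>

lemma eval_H_poly_inv:
  "coeff_map (\<lambda>p. poly p c) H_poly * coeff_map (\<lambda>p. poly p c) H_poly_inv = 1"
  by (simp add: H_poly_inv eval_hom.coeff_map_1 flip: eval_hom.coeff_map_mult)

lemma eval_T_poly_nth:
  "fps_nth (coeff_map (\<lambda>p. poly p c) (T_poly K)) n
    = (- 1) ^ n * (c / q0) ^ (n * (n - 1) div 2) * fps_nth (coeff_map (\<lambda>p. poly p c) K) n"
  by (simp add: T_poly_def poly_monom power_divide)

text \<open>
  At \<open>u = 1\<close> the series \<^const>\<open>H_poly\<close> is \<^const>\<open>qexp\<close>, and the twist by \<^const>\<open>T_poly\<close> removes
  exactly the signs and powers of \<open>q\<close> that distinguish its inverse from it.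
\<close>

lemma T_poly_at_1: "coeff_map (\<lambda>p. poly p 1) (T_poly H_poly_inv) = qexp"
proof -
  have "coeff_map (\<lambda>p. poly p 1) H_poly = qexp"
    by (rule fps_ext) (simp add: H_poly_def qexp_def poly_monom)
  then have "qexp * coeff_map (\<lambda>p. poly p 1) H_poly_inv = 1"
    using eval_H_poly_inv[of 1] by simp
  then have "coeff_map (\<lambda>p. poly p 1) H_poly_inv = qexp_inv"
    using qexp_mult_qexp_inv by (metis fps_inverse_unique)
  then show ?thesis
    by (intro fps_ext) (simp only: eval_T_poly_nth,
      simp add: qexp_def qexp_inv_def power_divide q0_nonzero flip: power_mult_distrib)
qed

text \<open>
  At \<open>u = q\<close> the series \<^const>\<open>H_poly\<close> is \<open>qexp_inv(-t)\<close>.  Its inverse is \<open>qexp(-t)\<close>, whose sign is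
  removed by \<^const>\<open>T_poly\<close>, the powers of \<open>q\<^sup>-\<^sup>1 u\<close> being \<open>1\<close>.
\<close>

lemma T_poly_at_q: "coeff_map (\<lambda>p. poly p q0) (T_poly H_poly_inv) = qexp"
proof -
  let ?s = "\<lambda>f. f oo (fps_const (- 1) * fps_X) :: Qq fps"
  have "coeff_map (\<lambda>p. poly p q0) H_poly = ?s qexp_inv"
    by (rule fps_ext) (simp only: fps_compose_linear, simp add: H_poly_def qexp_inv_def poly_monom
        flip: power_mult_distrib)
  then have "?s qexp_inv * coeff_map (\<lambda>p. poly p q0) H_poly_inv = 1"
    using eval_H_poly_inv[of q0] by simp
  moreover have "?s qexp_inv * ?s qexp = 1"
    using qexp_mult_qexp_inv by (simp add: mult.commute flip: fps_compose_mult_distrib)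
  ultimately have "coeff_map (\<lambda>p. poly p q0) H_poly_inv = ?s qexp"
    by (metis fps_inverse_unique)
  then show ?thesis
    by (intro fps_ext) (simp only: eval_T_poly_nth fps_compose_linear,
      simp add: qexp_def q0_nonzero flip: power_mult_distrib)
qed

lemma triangular_pos: "n \<ge> 2 \<Longrightarrow> n * (n - 1) div 2 > (0::nat)"
proof -
  assume "n \<ge> 2"
  then have "2 * 1 \<le> n * (n - 1)" by (intro mult_le_mono) auto
  then show ?thesis by linarith
qed

text \<open>
  At \<open>u = 0\<close> all coefficients from degree \<open>2\<close> on are killed by the factor \<open>(q\<^sup>-\<^sup>1 u)\<^bsup>n(n-1)/2\<^esup>\<close>.
\<close>

lemma T_poly_at_0: "coeff_map (\<lambda>p. poly p 0) (T_poly H_poly_inv) = 1 + fps_const (1 / (1 - q0)) * fps_X"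
proof (rule fps_ext)
  fix n :: nat
  let ?K = "coeff_map (\<lambda>p. poly p 0) H_poly_inv"
  consider "n = 0" | "n = 1" | "n \<ge> 2" by linarith
  then show "fps_nth (coeff_map (\<lambda>p. poly p 0) (T_poly H_poly_inv)) n
      = fps_nth (1 + fps_const (1 / (1 - q0)) * fps_X) n"
  proof cases
    case 2
    have "fps_nth (coeff_map (\<lambda>p. poly p 0) H_poly * ?K) 1 = 0"
      by (simp add: eval_H_poly_inv)
    then have "fps_nth ?K 1 = - (1 / (1 - q0))"
      by (simp add: fps_mult_nth_1 H_poly_inv_nth_0 H_poly_def poly_monom qpoch_def eq_neg_iff_add_eq_0)
    with 2 show ?thesis unfolding eval_T_poly_nth by simp
  next
    case 3
    then show ?thesis using triangular_pos[OF 3] unfolding eval_T_poly_nth by (simp add: zero_power)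
  qed (simp add: T_poly_H_poly_inv_nth_0)
qed

section \<open>Divisibility and the constant term\<close>

text \<open>
  At both \<open>u = 1\<close> and \<open>u = q\<close> the plethystic logarithm is \<open>t / (1 - q)\<close>, so its coefficients of
  degree at least \<open>2\<close> have the two distinct roots \<open>1\<close> and \<open>q\<close>.
\<close>

lemma coeff_poly_pleth_Log_dvd:
  assumes "d \<ge> 2"
  obtains C where "fps_nth (poly_pleth_Log (T_poly H_poly_inv)) d = [:- 1, 1:] * [:- q0, 1:] * C"
proof -
  define L where "L = fps_nth (poly_pleth_Log (T_poly H_poly_inv)) d"
  have adams_1: "adams_q i 1 = 1 ^ i" if "i > 0" for i
    using inj_ring_hom_adams_q[OF that] by (simp add: inj_ring_hom_def)
  have "poly L 1 = 0"
    using arg_cong[OF eval_poly_pleth_Log[OF adams_1, of "T_poly H_poly_inv"], of "\<lambda>f. fps_nth f d"] assms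
    by (simp add: T_poly_at_1 pleth_Log_q_qexp_nth L_def)
  moreover have "poly L q0 = 0"
    using arg_cong[OF eval_poly_pleth_Log[OF adams_q_q0, of "T_poly H_poly_inv"], of "\<lambda>f. fps_nth f d"] assms
    by (simp add: T_poly_at_q pleth_Log_q_qexp_nth L_def)
  moreover obtain M where M: "L = [:- 1, 1:] * M"
    using \<open>poly L 1 = 0\<close> by (auto simp: poly_eq_0_iff_dvd elim: dvdE)
  ultimately have "poly M q0 = 0" using q0_neq_1 by simp
  then obtain C where "M = [:- q0, 1:] * C" by (auto simp: poly_eq_0_iff_dvd elim: dvdE)
  with M have "L = [:- 1, 1:] * [:- q0, 1:] * C" by (simp only: mult.assoc)
  then show ?thesis using that unfolding L_def by blast
qed

lemma poly_pleth_Log_at_0: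
  assumes "d > 0"
  shows "poly (fps_nth (poly_pleth_Log (T_poly H_poly_inv)) d) 0 =
    - (1 / of_nat d) * (\<Sum>i | i dvd d. of_int (moebius_mu i) / (q0 ^ i - 1) ^ (d div i))"
proof -
  have "adams_q i 0 = 0 ^ i" if "i > 0" for i
    using inj_ring_hom_0[OF inj_ring_hom_adams_q[OF that]] that by (simp add: zero_power)
  from arg_cong[OF eval_poly_pleth_Log[OF this, of "T_poly H_poly_inv"], of "\<lambda>f. fps_nth f d"] show ?thesis
    using assms by (simp only: T_poly_at_0 pleth_Log_q_linear_nth coeff_map_nth)
qed

text \<open>
  The product in the denominator of the defining equation of \<^const>\<open>a_bar\<close>; at a prime power \<open>q\<close> it
  is the order of the general linear group of rank \<open>d\<close>.
\<close>

definition GL_order :: "nat \<Rightarrow> Qq" where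
  "GL_order d = (\<Prod>k<d. q0 ^ d - q0 ^ k)"

lemma GL_order_eq: "GL_order d = q0 ^ (d * (d - 1) div 2) * (\<Prod>k=1..d. q0 ^ k - 1)"
proof -
  have "GL_order d = (\<Prod>k<d. q0 ^ k * (q0 ^ (d - k) - 1))"
    unfolding GL_order_def by (intro prod.cong refl) (simp add: algebra_simps flip: power_add)
  also have "\<dots> = q0 ^ (\<Sum>k<d. k) * (\<Prod>k<d. q0 ^ (d - k) - 1)"
    by (simp add: prod.distrib power_sum)
  also have "(\<Prod>k<d. q0 ^ (d - k) - 1) = (\<Prod>k=1..d. q0 ^ k - 1)"
    by (rule prod.reindex_bij_witness[of _ "\<lambda>k. d - k" "\<lambda>k. d - k"]) auto
  also have "(\<Sum>k<d. k) = d * (d - 1) div 2"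
    using gauss_sum_nat[of "d - 1"] by (cases d) (simp_all add: lessThan_Suc_atMost atMost_atLeast0 mult.commute)
  finally show ?thesis .
qed

lemma GL_order_nonzero: "GL_order d \<noteq> 0"
  unfolding GL_order_eq using q0_nonzero q0_power_eq_1_iff by auto

lemma to_fract_GL_order: "to_fract [:GL_order d:] = (\<Prod>k<d. q1 ^ d - q1 ^ k)"
proof -
  note h = inj_ring_hom_const[where 'a = Qq]
  have h1: "to_fract [:1::Qq:] = 1" and hm: "to_fract [:a * b:] = to_fract [:a:] * to_fract [:b:]" for a b :: Qq
    using h unfolding inj_ring_hom_def by blast+
  have "to_fract [:\<Prod>k<m. q0 ^ d - q0 ^ k:] = (\<Prod>k<m. q1 ^ d - q1 ^ k)" for m
    by (induction m) (simp_all add: h1 hm inj_ring_hom_minus[OF h] inj_ring_hom_power[OF h] q1_def)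
  then show ?thesis by (simp add: GL_order_def)
qed

text \<open>
  The minus sign comes from comparing the factor \<open>1 - q\<close> in \<^const>\<open>a_rat\<close> with the factor \<open>q - 1\<close> in
  the definition of \<^const>\<open>a_bar\<close>.
\<close>

lemma a_bar_eq:
  assumes "fps_nth (poly_pleth_Log (T_poly H_poly_inv)) d = [:- 1, 1:] * [:- q0, 1:] * C"
  shows "a_bar d = smult (- GL_order d) C"
proof -
  define X where "X = (\<Prod>k<d. q1 ^ d - q1 ^ k)"
  define F where "F = (q1 - 1) * u1 ^ d * (u1 - 1) * (u1 - q1) / X"
  have u_minus: "to_fract [:- c, 1:] = u1 - to_fract [:c:]" for c :: Qq
    unfolding u1_def by (simp flip: to_fract_diff)
  have one: "to_fract [:1::Qq:] = 1" by (simp flip: one_pCons)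
  have X: "X \<noteq> 0"
    using GL_order_nonzero[of d] unfolding X_def to_fract_GL_order[symmetric] by simp
  have "to_fract (smult (- GL_order d) C) = - X * to_fract C"
    unfolding X_def to_fract_GL_order[symmetric] by (simp flip: to_fract_mult to_fract_uminus)
  then have "F * to_fract (smult (- GL_order d) C) = - ((q1 - 1) * u1 ^ d * (u1 - 1) * (u1 - q1)) * to_fract C"
    using X by (simp add: F_def)
  moreover have "a_rat d = (1 - q1) * u1 ^ d * ((u1 - 1) * (u1 - q1) * to_fract C)"
    unfolding a_rat_eq assms to_fract_mult u_minus one q1_def ..
  ultimately have eq: "a_rat d = F * to_fract (smult (- GL_order d) C)"
    by (simp add: algebra_simps)
  have "to_fract [:-1, 1:] \<noteq> (0 :: Qqu)" "to_fract [:- q0, 1:] \<noteq> 0" "to_fract [:q0 - 1:] \<noteq> 0"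
    using q0_neq_1 by simp_all
  then have "F \<noteq> 0"
    using X u1_nonzero unfolding F_def u_minus one q1_def
    by (simp add: inj_ring_hom_minus[OF inj_ring_hom_const] one)
  then have "F * to_fract (smult (- GL_order d) C) = F * to_fract p \<longleftrightarrow> p = smult (- GL_order d) C" for p
    by (simp only: mult_cancel_left to_fract_eq_iff) blast
  then show ?thesis
    unfolding a_bar_def X_def[symmetric] F_def[symmetric] eq by (intro the_equality) blast+
qed

text \<open>
  At \<open>u = 0\<close> the factor \<open>(u - 1) (u - q)\<close> is \<open>q\<close>.  It lowers the exponent \<open>d(d-1)/2\<close> of \<open>q\<close> in
  \<^const>\<open>GL_order\<close> to \<open>(d+1)(d-2)/2\<close>.
\<close>

lemma coeff_a_bar_0:
  assumes "d \<ge> 2"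
  shows "coeff (a_bar d) 0 =
    q0 ^ ((d + 1) * (d - 2) div 2) * (1 / of_nat d) * (\<Prod>k=1..d. q0 ^ k - 1) *
    (\<Sum>i | i dvd d. of_int (moebius_mu i) / (q0 ^ i - 1) ^ (d div i))"
proof -
  obtain C where C: "fps_nth (poly_pleth_Log (T_poly H_poly_inv)) d = [:- 1, 1:] * [:- q0, 1:] * C"
    using coeff_poly_pleth_Log_dvd[OF assms] .
  define S where "S = (\<Sum>i | i dvd d. of_int (moebius_mu i) / (q0 ^ i - 1) ^ (d div i))"
  have L0: "q0 * poly C 0 = - (1 / of_nat d) * S"
    using poly_pleth_Log_at_0[of d] assms unfolding C S_def[symmetric] by simp
  obtain e where e: "d = e + 2" using assms by (metis add.commute le_Suc_ex)
  have "d * (d - 1) = (d + 1) * (d - 2) + 2"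
    by (simp add: e algebra_simps)
  then have "d * (d - 1) div 2 = Suc ((d + 1) * (d - 2) div 2)"
    by simp
  then have "GL_order d = q0 * (q0 ^ ((d + 1) * (d - 2) div 2) * (\<Prod>k=1..d. q0 ^ k - 1))"
    unfolding GL_order_eq by simp
  then have "coeff (a_bar d) 0 =
      - (q0 ^ ((d + 1) * (d - 2) div 2) * (\<Prod>k=1..d. q0 ^ k - 1)) * (q0 * poly C 0)"
    unfolding a_bar_eq[OF C] by (simp add: poly_0_coeff_0)
  then show ?thesis
    unfolding L0 S_def[symmetric] by (simp add: mult_ac)
qed

theorem proposition4p8:
  fixes d :: nat
  assumes "d \<ge> 2"
  shows "coeff (a_bar d) 0 =
      q0 ^ ((d + 1) * (d - 2) div 2) * (1 / of_nat d) * (\<Prod>k=1..d. q0 ^ k - 1) *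
      (\<Sum>(i, j) \<in> {(i, j). i > 0 \<and> j > 0 \<and> i * j = d}. of_int (moebius_mu i) / (q0 ^ i - 1) ^ j)
    \<and> has_value_at (coeff (a_bar d) 0) 1 (fact (d - 1))"
proof
  have "i > 0 \<and> d div i > 0 \<and> i * (d div i) = d" if "i dvd d" for i
  proof -
    have "i * (d div i) = d" using that by simp
    with assms show ?thesis by (metis gr0I mult_0 mult_0_right not_numeral_le_zero)
  qed
  then have "(\<Sum>i | i dvd d. of_int (moebius_mu i) / (q0 ^ i - 1) ^ (d div i)) =
      (\<Sum>(i, j) \<in> {(i, j). i > 0 \<and> j > 0 \<and> i * j = d}. of_int (moebius_mu i) / (q0 ^ i - 1) ^ j)"
    by (intro sum.reindex_bij_witness[of _ fst "\<lambda>i. (i, d div i)"]) auto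
  then show "coeff (a_bar d) 0 =
      q0 ^ ((d + 1) * (d - 2) div 2) * (1 / of_nat d) * (\<Prod>k=1..d. q0 ^ k - 1) *
      (\<Sum>(i, j) \<in> {(i, j). i > 0 \<and> j > 0 \<and> i * j = d}. of_int (moebius_mu i) / (q0 ^ i - 1) ^ j)"
    unfolding coeff_a_bar_0[OF assms] by (simp only:)
  show "has_value_at (coeff (a_bar d) 0) 1 (fact (d - 1))"
    unfolding coeff_a_bar_0[OF assms] by (rule has_value_at_const_term) (use assms in simp)
qed

end
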